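(* Let $p$ be a prime, let $\alpha_1,\alpha_2,\dots$ be power series in $\mathbb{F}_p[[x]]$, and let $f\in\mathbb{F}_p[[x]]$ be a nonzero power series satisfying $\operatorname{dlog}_k(f)=\alpha_k$ for all $k\ge1$. If $\mathbb{F}_p(x)[\alpha_i]_{i\ge1}$ is an infinite extension of $\mathbb{F}_p(x)$, then $f$ is transcendental over $\mathbb{F}_p[x]$.
   Context: The higher (Hasse) derivatives $\partial_k$ on $\mathbb{F}_p((x))$ are the $\mathbb{F}_p$-linear operators with $\partial_k(x^n)=\binom{n}{k}x^{n-k}$ (formally $\frac{1}{k!}\frac{d^k}{dx^k}$). The higher logarithmic derivative is $\operatorname{dlog}_k(f)=\partial_k(f)/f$ for nonzero $f$. *)

theory Defs
  imports
    "HOL-Computational_Algebra.Computational_Algebra"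
    "Berlekamp_Zassenhaus.Finite_Field"
begin

text \<open>
  The prime field with \<open>p = CARD('p)\<close> elements is the type \<open>'p mod_ring\<close> with \<open>'p\<close> of class
  \<open>prime_card\<close>. Over a field \<open>'a\<close>, the types \<open>'a poly\<close>, \<open>'a poly fract\<close>, \<open>'a fps\<close> and \<open>'a fls\<close>
  are the polynomials, rational functions, power series and Laurent series in \<open>x\<close>.
\<close>

text \<open>
  \<open>ibinomial n k\<close> is the binomial coefficient with an arbitrary integer upper argument. The
  library's \<open>gbinomial\<close> has the same definition, but its sort constraint \<open>field_char_0\<close> excludes
  the integers. The division is exact.
\<close>

definition ibinomial :: "int \<Rightarrow> nat \<Rightarrow> int" where
  "ibinomial n k = (\<Prod>i = 0..<k. n - int i) div fact k"

lemma fact_mult_ibinomial: "fact k * ibinomial n k = (\<Prod>i = 0..<k. n - int i)"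
  using gbinomial_int_mult_fact[of k n] by (simp add: ibinomial_def gbinomial_prod_rev)

lemma ibinomial_of_nat: "ibinomial (int n) k = int (n choose k)"
  using gbinomial_int_binomial[of "int n" k] by (simp add: ibinomial_def gbinomial_prod_rev)

text \<open>
  The term of exponent \<open>n\<close> of the derivative comes from the term of exponent \<open>n + k\<close>. This is the
  linear extension of \<open>hasse_deriv_X_intpow\<close> below to infinite sums.
\<close>

lift_definition hasse_deriv :: "nat \<Rightarrow> 'a::comm_ring_1 fls \<Rightarrow> 'a fls"
  is "\<lambda>k f n. of_int (ibinomial (n + int k) k) * f (n + int k)"
proof -
  fix k :: nat and f :: "int \<Rightarrow> 'a"
  assume "\<forall>\<^sub>\<infinity>n::nat. f (- int n) = 0"
  then obtain m where m: "\<And>n. n > m \<Longrightarrow> f (- int n) = 0"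
    by (auto simp: MOST_nat)
  have "of_int (ibinomial (- int n + int k) k) * f (- int n + int k) = 0" if "n > m + k" for n
  proof -
    have "- int n + int k = - int (n - k)" "n - k > m" using that by auto
    then have "f (- int n + int k) = 0" using m by metis
    then show ?thesis by simp
  qed
  then show "\<forall>\<^sub>\<infinity>n::nat. of_int (ibinomial (- int n + int k) k) * f (- int n + int k) = 0"
    unfolding MOST_nat by blast
qed

lemma hasse_deriv_add: "hasse_deriv k (f + g) = hasse_deriv k f + hasse_deriv k g"
  by (rule fls_eqI) (simp add: hasse_deriv.rep_eq algebra_simps)

lemma hasse_deriv_scale: "hasse_deriv k (fls_const c * f) = fls_const c * hasse_deriv k f"
  by (rule fls_eqI) (simp add: hasse_deriv.rep_eq algebra_simps)

lemma hasse_deriv_X_intpow: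
  "hasse_deriv k (fls_X_intpow n :: 'a::comm_ring_1 fls) =
     fls_const (of_int (ibinomial n k)) * fls_X_intpow (n - int k)"
proof (rule fls_eqI)
  fix m :: int
  have "m + int k = n \<longleftrightarrow> m = n - int k" by auto
  then show "fls_nth (hasse_deriv k (fls_X_intpow n :: 'a fls)) m =
      fls_nth (fls_const (of_int (ibinomial n k)) * fls_X_intpow (n - int k)) m"
    by (cases "m = n - int k") (simp_all add: hasse_deriv.rep_eq)
qed

definition higher_dlog :: "nat \<Rightarrow> 'a::field fls \<Rightarrow> 'a fls" where
  "higher_dlog k f = hasse_deriv k f / f"

abbreviation poly_to_fls :: "'a::field poly \<Rightarrow> 'a fls" where
  "poly_to_fls q \<equiv> fps_to_fls (fps_of_poly q)"

definition ratfun_to_fls :: "'a::field_gcd poly fract \<Rightarrow> 'a fls" where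
  "ratfun_to_fls q =
     poly_to_fls (fst (quot_of_fract q)) / poly_to_fls (snd (quot_of_fract q))"

lemma ratfun_to_fls_Fract:
  assumes "b \<noteq> 0"
  shows "ratfun_to_fls (Fract a b) = poly_to_fls a / poly_to_fls b"
proof -
  define c d where "c = fst (quot_of_fract (Fract a b))" and "d = snd (quot_of_fract (Fract a b))"
  have d: "d \<noteq> 0" by (simp add: d_def)
  have "Fract c d = Fract a b" by (simp add: c_def d_def Fract_quot_of_fract)
  then have eq: "c * b = a * d" using assms d by (simp add: eq_fract)
  have "poly_to_fls c * poly_to_fls b = poly_to_fls a * poly_to_fls d"
    using arg_cong[OF eq, of poly_to_fls] by (simp add: fps_of_poly_mult fls_times_fps_to_fls)
  moreover have "poly_to_fls b \<noteq> 0" "poly_to_fls d \<noteq> 0" using assms d by auto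
  ultimately show ?thesis
    by (simp add: ratfun_to_fls_def frac_eq_eq flip: c_def d_def)
qed

lemma ratfun_to_fls_1: "ratfun_to_fls 1 = 1"
  by (simp add: One_fract_def ratfun_to_fls_Fract)

lemma ratfun_to_fls_add: "ratfun_to_fls (q + r) = ratfun_to_fls q + ratfun_to_fls r"
proof (cases q; cases r)
  fix a b c d :: "'a poly"
  assume qr: "q = Fract a b" "b \<noteq> 0" "r = Fract c d" "d \<noteq> 0"
  then have "poly_to_fls b \<noteq> 0" "poly_to_fls d \<noteq> 0" by auto
  with qr show ?thesis
    by (simp add: ratfun_to_fls_Fract fps_of_poly_mult fps_of_poly_add fls_times_fps_to_fls
        add_frac_eq)
qed

lemma ratfun_to_fls_mult: "ratfun_to_fls (q * r) = ratfun_to_fls q * ratfun_to_fls r"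
  by (cases q; cases r)
    (simp add: ratfun_to_fls_Fract fps_of_poly_mult fls_times_fps_to_fls)

definition ratfun_scale :: "'a::field_gcd poly fract \<Rightarrow> 'a fls \<Rightarrow> 'a fls" where
  "ratfun_scale q f = ratfun_to_fls q * f"

global_interpretation ratfun: vector_space "ratfun_scale :: 'a::field_gcd poly fract \<Rightarrow> _"
  by unfold_locales
    (simp_all add: ratfun_scale_def ratfun_to_fls_add ratfun_to_fls_mult ratfun_to_fls_1
      algebra_simps)

text \<open>
  The subring \<open>K[S]\<close> of the Laurent series generated by \<open>S\<close> over the field \<open>K\<close> of rational
  functions; it is closed under negation since it contains \<open>-1\<close>.
\<close>

inductive_set ratfun_adjoin :: "'a::field_gcd fls set \<Rightarrow> 'a fls set" for S where
  scalar: "ratfun_to_fls q \<in> ratfun_adjoin S"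
| gen: "s \<in> S \<Longrightarrow> s \<in> ratfun_adjoin S"
| add: "u \<in> ratfun_adjoin S \<Longrightarrow> v \<in> ratfun_adjoin S \<Longrightarrow> u + v \<in> ratfun_adjoin S"
| mult: "u \<in> ratfun_adjoin S \<Longrightarrow> v \<in> ratfun_adjoin S \<Longrightarrow> u * v \<in> ratfun_adjoin S"

definition infinite_extension :: "'a::field_gcd fls set \<Rightarrow> bool" where
  "infinite_extension R \<longleftrightarrow> \<not> (\<exists>B. finite B \<and> B \<subseteq> R \<and> ratfun.span B = R)"

definition transcendental_over_polys :: "'a::field fps \<Rightarrow> bool" where
  "transcendental_over_polys f \<longleftrightarrow>
     (\<forall>P :: 'a poly poly. P \<noteq> 0 \<longrightarrow> poly (map_poly fps_of_poly P) f \<noteq> 0)"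

end

theory Submission
  imports Defs
begin

text \<open>
  Let \<open>K\<close> be the field of rational functions and \<open>q\<close> a power of \<open>p\<close>. Every Laurent series is
  uniquely \<open>h = \<Sum>\<^sub>j\<^sub><\<^sub>q x\<^sup>j T\<^sub>j(h)\<^sup>q\<close>, and the maps \<open>T\<^sub>j\<close> preserve \<open>K\<close> and satisfy
  \<open>T\<^sub>j(g\<^sup>q h) = g T\<^sub>j(h)\<close>. Hence \<open>q\<close>-th powers of \<open>K\<close>-independent series are \<open>K\<close>-independent.
  If \<open>f\<close> is algebraic, then \<open>F = K[f]\<close> is finite-dimensional, so the \<open>q\<close>-th powers of a basis of \<open>F\<close>
  form a basis again, and therefore \<open>T\<^sub>j\<close> preserves \<open>F\<close>. For \<open>k < q\<close> the operator \<open>\<partial>\<^sub>k\<close> is linear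
  over \<open>q\<close>-th powers, so \<open>\<partial>\<^sub>k f = \<Sum>\<^sub>j\<^sub><\<^sub>q \<partial>\<^sub>k(x\<^sup>j) T\<^sub>j(f)\<^sup>q\<close> lies in \<open>F\<close>. Thus all \<open>\<alpha>\<^sub>k\<close> lie in \<open>F\<close>
  and generate a finite extension.
\<close>

section \<open>Coefficients of \<open>q\<close>-th powers, for \<open>q\<close> a power of
  \<open>p\<close>\<close>

lemma mod_ring_power_card_power [simp]:
  "(c :: 'p::prime_card mod_ring) ^ (CARD('p) ^ m) = c"
  by (rule finite_field_power_card_power_eq_same[where n = m]) simp

text \<open>Write g = c + x h. The Frobenius identity and c^q = c give g^q = c + x^q h^q, so the
  coefficient at \<open>n\<close> comes from that of h^q at \<open>n - q\<close>; the induction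
  therefore varies \<open>g\<close>.\<close>

lemma fps_nth_power_card_power:
  fixes g :: "'p::prime_card mod_ring fps"
  assumes q: "q = CARD('p) ^ m"
  shows "fps_nth (g ^ q) n = (if q dvd n then fps_nth g (n div q) else 0)"
proof (induction n arbitrary: g rule: less_induct)
  case (less n)
  have q0: "q > 0" by (simp add: q)
  define h where "h = fps_shift 1 g"
  have "g = fps_const (fps_nth g 0) + h * fps_X"
    by (rule fps_ext) (simp add: h_def)
  then have "g ^ q = (fps_const (fps_nth g 0) + h * fps_X) ^ q" by simp
  also have "\<dots> = fps_const (fps_nth g 0) ^ q + (h * fps_X) ^ q"
    using freshmans_dream'[where 'a = "'p mod_ring fps" and m = q and n = m]
      prime_card[where 'a = 'p]
    by (simp add: q)
  also have "\<dots> = fps_const (fps_nth g 0) + h ^ q * fps_X ^ q"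
    by (simp add: power_mult_distrib fps_const_power q)
  finally have "fps_nth (g ^ q) n =
      (if n = 0 then fps_nth g 0 else 0) + (if n < q then 0 else fps_nth (h ^ q) (n - q))"
    by (simp add: fps_X_power_mult_right_nth)
  also have "\<dots> = (if q dvd n then fps_nth g (n div q) else 0)"
  proof (cases "n < q")
    case True
    then show ?thesis by (auto dest: dvd_imp_le)
  next
    case False
    with q0 have "fps_nth (h ^ q) (n - q) =
        (if q dvd n - q then fps_nth h ((n - q) div q) else 0)"
      by (intro less.IH) auto
    with False q0 show ?thesis
      by (simp add: h_def dvd_minus_self le_div_geq)
  qed
  finally show ?case .
qed

lemma fls_nth_power_card_power:
  fixes g :: "'p::prime_card mod_ring fls"
  assumes q: "q = CARD('p) ^ m"
  shows "fls_nth (g ^ q) n = (if int q dvd n then fls_nth g (n div int q) else 0)"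
proof -
  have q0: "q > 0" by (simp add: q)
  \<comment> \<open>Factoring out x^(-N) leaves a power series \<open>h\<close>, and g^q = x^(-qN)
    h^q.\<close>
  obtain h N where g: "g = fls_shift N (fps_to_fls h)"
    using fls_as_fps'[of g "- fls_subdegree g"] by auto
  have "g ^ q = fls_shift (int q * N) (fps_to_fls (h ^ q))"
    by (simp add: g fls_shifted_pow fps_to_fls_power)
  then have "fls_nth (g ^ q) n = fls_nth (fps_to_fls (h ^ q)) (n + int q * N)" by simp
  also have "\<dots> = (if int q dvd n then fls_nth g (n div int q) else 0)"
  proof (cases "int q dvd n")
    case True
    then obtain d where "n = int q * d" by blast
    then have n: "n + int q * N = int q * (d + N)" "n div int q = d"
      using q0 by (simp_all add: algebra_simps)
    show ?thesis
    proof (cases "d + N < 0")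
      case True
      then have "int q * (d + N) < 0" using q0 by (simp add: mult_less_0_iff)
      with True \<open>int q dvd n\<close> show ?thesis by (simp add: n g)
    next
      case False
      then obtain e where e: "d + N = int e" by (metis nonneg_int_cases not_less)
      have "\<not> int q * int e < 0" by (simp add: not_less)
      with \<open>int q dvd n\<close> show ?thesis
        using q0 by (simp add: n g e fps_nth_power_card_power[OF q] nat_mult_distrib)
    qed
  next
    case False
    then have "\<not> int q dvd n + int q * N" by (simp add: dvd_add_left_iff)
    then have "n + int q * N \<ge> 0 \<Longrightarrow> \<not> q dvd nat (n + int q * N)"
      by (metis int_dvd_int_iff nat_0_le)
    with False show ?thesis by (simp add: fps_nth_power_card_power[OF q])
  qed
  finally show ?thesis .
qed

section \<open>The sections and the decomposition by residues modulo \<open>q\<close>\<close>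

lift_definition fls_section :: "nat \<Rightarrow> nat \<Rightarrow> 'a::zero fls \<Rightarrow> 'a fls"
  is "\<lambda>q j f n. if q = 0 then 0 else f (int q * n + int j)"
proof -
  fix q j :: nat and f :: "int \<Rightarrow> 'a"
  assume "\<forall>\<^sub>\<infinity>n::nat. f (- int n) = 0"
  then obtain m where m: "\<And>n. n > m \<Longrightarrow> f (- int n) = 0"
    by (auto simp: MOST_nat)
  have "(if q = 0 then 0 else f (int q * - int n + int j)) = 0" if "n > m + j" for n
  \<comment> \<open>For \<open>q = 0\<close> the formula would repeat the coefficient at
    \<open>j\<close> at every exponent, which in general is no Laurent series; hence the default
    0.\<close>
  proof (cases "q = 0")
    case False
    have "n \<le> q * n" using False by simp
    with that have "j \<le> q * n" "q * n - j > m" by linarith+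
    moreover from this have "int q * - int n + int j = - int (q * n - j)"
      by (simp add: of_nat_diff)
    ultimately show ?thesis using m by metis
  qed simp
  then show "\<forall>\<^sub>\<infinity>n::nat. (if q = 0 then 0 else f (int q * - int n + int j)) = 0"
    unfolding MOST_nat by blast
qed

lemma fls_section_0 [simp]: "fls_section q j 0 = 0"
  by (rule fls_eqI) (simp add: fls_section.rep_eq)

lemma fls_section_add:
  "fls_section q j (f + g :: 'a::monoid_add fls) = fls_section q j f + fls_section q j g"
  by (rule fls_eqI) (simp add: fls_section.rep_eq)

lemma fls_section_sum:
  "fls_section q j (\<Sum>i\<in>A. f i :: 'a::comm_monoid_add fls) = (\<Sum>i\<in>A. fls_section q j (f i))"
  by (induction A rule: infinite_finite_induct) (simp_all add: fls_section_add)

text \<open>Exactly one \<open>j < q\<close> is congruent to \<open>n\<close>. This evaluates the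
  coefficient at \<open>n\<close> of a sum of terms x^j g_j^q.\<close>

lemma sum_residue_class:
  fixes F :: "nat \<Rightarrow> 'a::comm_monoid_add"
  assumes "q > 0"
  shows "(\<Sum>j<q. if int q dvd n - int j then F j else 0) = F (nat (n mod int q))"
proof -
  have "int q dvd n - int j \<longleftrightarrow> j = nat (n mod int q)" if "j < q" for j
  proof -
    have "int q dvd n - int j \<longleftrightarrow> n mod int q = int j mod int q"
      by (simp add: mod_eq_dvd_iff)
    also have "\<dots> \<longleftrightarrow> j = nat (n mod int q)"
      using that by auto
    finally show ?thesis .
  qed
  then have "(\<Sum>j<q. if int q dvd n - int j then F j else 0) =
      (\<Sum>j<q. if j = nat (n mod int q) then F j else 0)"
    by (intro sum.cong) auto
  also have "\<dots> = F (nat (n mod int q))"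
    using assms by (auto simp: nat_less_iff)
  finally show ?thesis .
qed

lemma fls_nth_X_power_times:
  "fls_nth (fls_X ^ j * g :: 'a::comm_ring_1 fls) n = fls_nth g (n - int j)"
  by (simp add: fls_X_power_times_conv_shift)

context
  fixes q m :: nat
  assumes q: "q = CARD('p::prime_card) ^ m"
begin

lemma card_power_pos: "q > 0"
  by (simp add: q)

lemma fls_section_decomp:
  fixes h :: "'p mod_ring fls"
  shows "h = (\<Sum>j<q. fls_X ^ j * fls_section q j h ^ q)"
proof (rule fls_eqI)
  fix n
  have "fls_nth (\<Sum>j<q. fls_X ^ j * fls_section q j h ^ q) n =
      (\<Sum>j<q. if int q dvd n - int j then fls_nth h n else 0)"
    using card_power_pos
    by (auto simp: fls_nth_sum fls_nth_X_power_times fls_nth_power_card_power[OF q]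
        fls_section.rep_eq intro!: sum.cong)
  then show "fls_nth h n = fls_nth (\<Sum>j<q. fls_X ^ j * fls_section q j h ^ q) n"
    using sum_residue_class[OF card_power_pos, of n "\<lambda>_. fls_nth h n"] by simp
qed

text \<open>The uniqueness half of the decomposition: by additivity, the section with index
  \<open>j\<close> reads off the \<open>j\<close>-th component of any sum of terms x^i u_i^q with
  \<open>i < q\<close>.\<close>

lemma fls_section_X_power_times:
  fixes u :: "'p mod_ring fls"
  assumes "i < q" "j < q"
  shows "fls_section q j (fls_X ^ i * u ^ q) = (if i = j then u else 0)"
proof (rule fls_eqI)
  fix n
  have "int q dvd int q * n + int j - int i \<longleftrightarrow> i = j"
  proof -
    have "int q dvd int q * n + int j - int i \<longleftrightarrow> (int q * n + int j) mod int q = int i mod int q"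
      by (rule mod_eq_dvd_iff[symmetric])
    also have "\<dots> \<longleftrightarrow> i = j" using assms by auto
    finally show ?thesis .
  qed
  then show "fls_nth (fls_section q j (fls_X ^ i * u ^ q)) n =
      fls_nth (if i = j then u else 0) n"
    using card_power_pos
    by (auto simp: fls_section.rep_eq fls_nth_X_power_times fls_nth_power_card_power[OF q])
qed

text \<open>Multiplying the decomposition of \<open>h\<close> by g^q multiplies each component by
  \<open>g\<close>, and the sections read off components.\<close>

lemma fls_section_power_times:
  fixes g h :: "'p mod_ring fls"
  assumes "j < q"
  shows "fls_section q j (g ^ q * h) = g * fls_section q j h"
proof -
  have "g ^ q * h = g ^ q * (\<Sum>i<q. fls_X ^ i * fls_section q i h ^ q)"
    using fls_section_decomp[of h] by simp
  also have "\<dots> = (\<Sum>i<q. fls_X ^ i * (g * fls_section q i h) ^ q)"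
    by (simp add: sum_distrib_left power_mult_distrib mult_ac)
  finally have "g ^ q * h = (\<Sum>i<q. fls_X ^ i * (g * fls_section q i h) ^ q)" .
  then have "fls_section q j (g ^ q * h) =
      (\<Sum>i<q. if i = j then g * fls_section q i h else 0)"
    using assms by (simp add: fls_section_sum fls_section_X_power_times)
  with assms show ?thesis by simp
qed

lemma fls_section_eq_0D:
  fixes h :: "'p mod_ring fls"
  assumes "\<And>j. j < q \<Longrightarrow> fls_section q j h = 0"
  shows "h = 0"
  using fls_section_decomp[of h] assms card_power_pos by (simp add: power_0_left)

end

lemma fls_section_poly:
  assumes "j < q"
  shows "\<exists>r'. fls_section q j (poly_to_fls r) = poly_to_fls r'"
proof -
  \<comment> \<open>The bound \<open>degree r\<close> suffices: for larger \<open>i\<close>, already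
    q i + j exceeds the degree of \<open>r\<close>.\<close>
  define r' where "r' = (\<Sum>i\<le>degree r. Polynomial.monom (poly.coeff r (q * i + j)) i)"
  have r': "poly.coeff r' n = poly.coeff r (q * n + j)" for n
  proof (cases "n \<le> degree r")
    case False
    have "n \<le> q * n" using assms by simp
    with False have "degree r < q * n + j" by linarith
    with False show ?thesis by (simp add: r'_def coeff_sum coeff_eq_0)
  qed (simp add: r'_def coeff_sum)
  have "fls_nth (fls_section q j (poly_to_fls r)) n = fls_nth (poly_to_fls r') n" for n
  proof (cases "n < 0")
    case False
    then have "\<not> int q * n + int j < 0" by (simp add: not_less)
    with False show ?thesis
      using assms by (simp add: fls_section.rep_eq r' nat_add_distrib nat_mult_distrib)
  next
    \<comment> \<open>Here \<open>j < q\<close> matters: for negative \<open>n\<close>, q n + j is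
      at most j - q, so no coefficient of \<open>r\<close> lands at a negative exponent.\<close>
    case True
    then have "n * int q \<le> - 1 * int q" by (intro mult_right_mono) auto
    with assms have "int q * n + int j < 0" by (simp add: mult.commute)
    with True show ?thesis using assms by (simp add: fls_section.rep_eq)
  qed
  then have "fls_section q j (poly_to_fls r) = poly_to_fls r'" by (intro fls_eqI) simp
  then show ?thesis by blast
qed

lemma ratfun_to_fls_eq_0_iff: "ratfun_to_fls c = 0 \<longleftrightarrow> c = 0"
proof (cases c)
  case (Fract a b)
  then show ?thesis by (auto simp: ratfun_to_fls_Fract Zero_fract_def eq_fract)
qed

lemma ratfun_to_fls_0 [simp]: "ratfun_to_fls 0 = 0"
  by (simp add: ratfun_to_fls_eq_0_iff)

lemma poly_to_fls_eq_ratfun: "poly_to_fls r = ratfun_to_fls (Fract r 1)"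
  by (simp add: ratfun_to_fls_Fract)

text \<open>Rewriting a/b as (1/b)^q (a b^(q-1)) makes the denominator a \<open>q\<close>-th power,
  which the section pulls out, and leaves a polynomial.\<close>

lemma fls_section_ratfun:
  fixes c :: "'p::prime_card mod_ring poly fract"
  assumes q: "q = CARD('p) ^ m" and j: "j < q"
  shows "\<exists>c'. fls_section q j (ratfun_to_fls c) = ratfun_to_fls c'"
proof (cases c)
  case (Fract a b)
  have q0: "q > 0" using j by simp
  obtain r where r: "fls_section q j (poly_to_fls (a * b ^ (q - 1))) = poly_to_fls r"
    using fls_section_poly[OF j] by blast
  have b: "poly_to_fls b \<noteq> 0" using Fract by simp
  have "ratfun_to_fls c = (1 / poly_to_fls b) ^ q * poly_to_fls (a * b ^ (q - 1))"
    using Fract b q0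
    by (cases q) (simp_all add: ratfun_to_fls_Fract fps_of_poly_mult fls_times_fps_to_fls
        fps_of_poly_power fps_to_fls_power power_divide field_simps)
  then have "fls_section q j (ratfun_to_fls c) = 1 / poly_to_fls b * poly_to_fls r"
    using fls_section_power_times[OF q j] by (simp only: r)
  also have "\<dots> = ratfun_to_fls (Fract r b)"
    using Fract by (simp add: ratfun_to_fls_Fract)
  finally show ?thesis by blast
qed

section \<open>Independent images of bases under \<open>q\<close>-th powers and
  multiplication\<close>

lemma (in vector_space) independent_image_spans:
  assumes "independent B" "finite B" "inj_on \<phi> B" "independent (\<phi> ` B)" "\<phi> ` B \<subseteq> span B"
  shows "span (\<phi> ` B) = span B"
proof (intro antisym subsetI)
  fix v
  assume v: "v \<in> span B"
  show "v \<in> span (\<phi> ` B)"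
  proof (rule ccontr)
    assume nv: "v \<notin> span (\<phi> ` B)"
    then have "independent (insert v (\<phi> ` B))"
      using assms by (intro independent_insertI)
    \<comment> \<open>A vector missed by the span would give \<open>card B + 1\<close> independent
      vectors inside the span of \<open>B\<close>.\<close>
    then have "card (insert v (\<phi> ` B)) \<le> card B"
      using independent_span_bound[OF \<open>finite B\<close>] v assms(5) by blast
    moreover have "v \<notin> \<phi> ` B" using nv span_base by blast
    ultimately show False
      using assms by (simp add: card_image)
  qed
next
  fix v
  assume "v \<in> span (\<phi> ` B)"
  then show "v \<in> span B"
    using span_minimal[OF assms(5) subspace_span] by blast
qed

text \<open>If \<open>\<Sum>\<^sub>b c\<^sub>b b\<^sup>q = 0\<close>, then applying the sections gives \<open>\<Sum>\<^sub>b T\<^sub>j(c\<^sub>b) b = 0\<close> for every \<open>j\<close>.\<close>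

lemma independent_power_card_power:
  fixes B :: "'p::prime_card mod_ring fls set"
  assumes q: "q = CARD('p) ^ m" and B: "ratfun.independent B" "finite B"
  shows "inj_on (\<lambda>b. b ^ q) B" "ratfun.independent ((\<lambda>b. b ^ q) ` B)"
proof -
  show inj: "inj_on (\<lambda>b. b ^ q) B"
  proof (rule inj_onI)
    fix b b' :: "'p mod_ring fls"
    assume "b ^ q = b' ^ q"
    moreover have "0 < q" using q by simp
    \<comment> \<open>The section with index 0 undoes the \<open>q\<close>-th power, as it fixes
      1.\<close>
    moreover from this have "fls_section q 0 (b ^ q * 1) = b * fls_section q 0 1"
      and "fls_section q 0 (b' ^ q * 1) = b' * fls_section q 0 1"
      by (simp_all only: fls_section_power_times[OF q])
    moreover have "fls_section q 0 (1 :: 'p mod_ring fls) = 1"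
      using fls_section_X_power_times[OF q, of 0 0 1] \<open>0 < q\<close> by simp
    ultimately show "b = b'" by simp
  qed
  show "ratfun.independent ((\<lambda>b. b ^ q) ` B)"
  proof (rule ratfun.independent_if_scalars_zero)
    show "finite ((\<lambda>b. b ^ q) ` B)" using B by simp
    fix c x
    assume sum0: "(\<Sum>x\<in>(\<lambda>b. b ^ q) ` B. ratfun_scale (c x) x) = 0"
      and "x \<in> (\<lambda>b. b ^ q) ` B"
    then obtain b where b: "b \<in> B" "x = b ^ q" by blast
    have sum0': "(\<Sum>b\<in>B. b ^ q * ratfun_to_fls (c (b ^ q))) = 0"
      using sum0 by (simp add: sum.reindex[OF inj] ratfun_scale_def mult_ac)
    have "fls_section q j (ratfun_to_fls (c (b ^ q))) = 0" if j: "j < q" for j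
    proof -
      \<comment> \<open>Sections of rational functions are rational, so every \<open>j\<close>
        yields a linear relation on \<open>B\<close> with scalars \<open>d b\<close>, which must
        vanish.\<close>
      have "\<forall>a. \<exists>c'. fls_section q j (ratfun_to_fls (c (a ^ q))) = ratfun_to_fls c'"
        using fls_section_ratfun[OF q j] by blast
      then obtain d where d: "\<And>a. fls_section q j (ratfun_to_fls (c (a ^ q))) = ratfun_to_fls (d a)"
        by metis
      have "0 = fls_section q j (\<Sum>b\<in>B. b ^ q * ratfun_to_fls (c (b ^ q)))"
        by (simp add: sum0')
      also have "\<dots> = (\<Sum>b\<in>B. ratfun_scale (d b) b)"
        by (simp add: fls_section_sum fls_section_power_times[OF q j] d ratfun_scale_def mult_ac)
      finally have "d b = 0"
        using B b ratfun.independentD[of B B d b] by simp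
      then show ?thesis by (simp add: d)
    qed
    then have "ratfun_to_fls (c (b ^ q)) = 0"
      by (rule fls_section_eq_0D[OF q])
    then show "c x = 0" by (simp add: ratfun_to_fls_eq_0_iff b)
  qed
qed

lemma independent_times:
  fixes B :: "'a::field_gcd fls set"
  assumes "g \<noteq> 0" and B: "ratfun.independent B" "finite B"
  shows "inj_on ((*) g) B" "ratfun.independent ((*) g ` B)"
proof -
  show inj: "inj_on ((*) g) B" using assms by (simp add: inj_on_def)
  show "ratfun.independent ((*) g ` B)"
  proof (rule ratfun.independent_if_scalars_zero)
    show "finite ((*) g ` B)" using B by simp
    fix c x
    assume sum0: "(\<Sum>x\<in>(*) g ` B. ratfun_scale (c x) x) = 0" and "x \<in> (*) g ` B"
    then obtain b where b: "b \<in> B" "x = g * b" by blast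
    have "g * (\<Sum>b\<in>B. ratfun_scale (c (g * b)) b) = 0"
      using sum0 sum.reindex[OF inj, of "\<lambda>x. ratfun_scale (c x) x"]
      by (simp add: ratfun_scale_def sum_distrib_left mult.left_commute)
    then have "(\<Sum>b\<in>B. ratfun_scale (c (g * b)) b) = 0" using assms by simp
    then show "c x = 0"
      using B b ratfun.independentD[of B B "\<lambda>b. c (g * b)" b] by simp
  qed
qed

section \<open>Finite-dimensional algebras over the rational functions\<close>

locale finite_ratfun_extension =
  fixes F :: "'p::prime_card mod_ring fls set" and B
  assumes finite_spanning: "finite B" "F = ratfun.span B"
    and one_mem: "1 \<in> F"
    and times_mem: "\<And>u v. u \<in> F \<Longrightarrow> v \<in> F \<Longrightarrow> u * v \<in> F"
begin

lemma subspace: "ratfun.subspace F"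
  by (simp add: finite_spanning)

lemma scalar_mem: "ratfun_to_fls c \<in> F"
  using ratfun.subspace_scale[OF subspace one_mem, of c] by (simp add: ratfun_scale_def)

lemma add_mem: "u \<in> F \<Longrightarrow> v \<in> F \<Longrightarrow> u + v \<in> F"
  by (rule ratfun.subspace_add[OF subspace])

lemma sum_mem: "(\<And>i. i \<in> A \<Longrightarrow> h i \<in> F) \<Longrightarrow> (\<Sum>i\<in>A. h i) \<in> F"
  by (rule ratfun.subspace_sum[OF subspace])

lemma power_mem: "u \<in> F \<Longrightarrow> u ^ n \<in> F"
  by (induction n) (simp_all add: one_mem times_mem)

lemma poly_mem: "poly_to_fls r \<in> F"
  by (simp only: poly_to_fls_eq_ratfun scalar_mem)

text \<open>An independent subset of \<open>F\<close> is no larger than the spanning set, hence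
  finite. Besides bases of \<open>F\<close>, this supplies finite generation of the algebra spanned
  by the logarithmic derivatives.\<close>

lemma obtain_basis:
  assumes "V \<subseteq> F" "ratfun.subspace V"
  obtains C where "C \<subseteq> V" "finite C" "ratfun.independent C" "ratfun.span C = V"
proof -
  obtain C where C: "C \<subseteq> V" "ratfun.independent C" "V \<subseteq> ratfun.span C"
    by (rule ratfun.maximal_independent_subset)
  moreover have "finite C"
    using ratfun.independent_span_bound[OF finite_spanning(1) C(2)] C(1) assms(1) finite_spanning(2)
    by blast
  moreover have "ratfun.span C = V"
    using C assms ratfun.span_minimal by blast
  ultimately show ?thesis using that by blast
qed

text \<open>A finite-dimensional domain is a field: multiplication by \<open>g\<close> carries a
  basis of \<open>F\<close> to an independent subset of \<open>F\<close>, which spans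
  \<open>F\<close> by counting, so \<open>h\<close> is \<open>g\<close> times an element of
  \<open>F\<close>.\<close>

lemma divide_mem:
  assumes "g \<in> F" "h \<in> F" "g \<noteq> 0"
  shows "h / g \<in> F"
proof -
  obtain C where C: "C \<subseteq> F" "finite C" "ratfun.independent C" "ratfun.span C = F"
    using obtain_basis[OF order_refl subspace] .
  have "(*) g ` C \<subseteq> ratfun.span C"
    unfolding C(4) using C(1) assms(1) by (blast intro: times_mem)
  then have "ratfun.span ((*) g ` C) = F"
    using ratfun.independent_image_spans C independent_times[OF assms(3) C(3,2)] by metis
  with assms have "h \<in> ratfun.span ((*) g ` C)" by simp
  then obtain c where "h = (\<Sum>v\<in>(*) g ` C. ratfun_scale (c v) v)"
    using C by (auto simp: ratfun.span_finite)
  also have "\<dots> = g * (\<Sum>v\<in>C. ratfun_scale (c (g * v)) v)"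
    using independent_times(1)[OF assms(3) C(3,2)]
    by (simp add: sum.reindex ratfun_scale_def sum_distrib_left mult.left_commute)
  finally have "h / g = (\<Sum>v\<in>C. ratfun_scale (c (g * v)) v)"
    using assms by simp
  also have "\<dots> \<in> F"
    using C by (intro sum_mem ratfun.subspace_scale[OF subspace]) auto
  finally show ?thesis .
qed

text \<open>Expand \<open>h\<close> in the basis of \<open>q\<close>-th powers b^q with rational
  coefficients. The section pulls out each \<open>b\<close> and acts only on the
  coefficients.\<close>

lemma section_mem:
  assumes q: "q = CARD('p) ^ m" and j: "j < q" and h: "h \<in> F"
  shows "fls_section q j h \<in> F"
proof -
  obtain C where C: "C \<subseteq> F" "finite C" "ratfun.independent C" "ratfun.span C = F"
    using obtain_basis[OF order_refl subspace] .
  note ind = independent_power_card_power[OF q C(3,2)]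
  have "(\<lambda>b. b ^ q) ` C \<subseteq> ratfun.span C"
    unfolding C(4) using C(1) by (blast intro: power_mem)
  then have "ratfun.span ((\<lambda>b. b ^ q) ` C) = F"
    using ratfun.independent_image_spans[OF C(3,2) ind] C by simp
  with h have "h \<in> ratfun.span ((\<lambda>b. b ^ q) ` C)" by simp
  then obtain c where "h = (\<Sum>v\<in>(\<lambda>b. b ^ q) ` C. ratfun_scale (c v) v)"
    using C by (auto simp: ratfun.span_finite)
  also have "\<dots> = (\<Sum>b\<in>C. b ^ q * ratfun_to_fls (c (b ^ q)))"
    using ind(1) by (simp add: sum.reindex ratfun_scale_def mult_ac)
  finally have "fls_section q j h = (\<Sum>b\<in>C. b * fls_section q j (ratfun_to_fls (c (b ^ q))))"
    by (simp add: fls_section_sum fls_section_power_times[OF q j])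
  also have "\<dots> \<in> F"
  proof (intro sum_mem times_mem)
    fix b
    show "fls_section q j (ratfun_to_fls (c (b ^ q))) \<in> F"
      using fls_section_ratfun[OF q j, of "c (b ^ q)"] scalar_mem by metis
  qed (use C in auto)
  finally show ?thesis .
qed

end

section \<open>Binomial coefficients modulo \<open>p\<close> and Hasse derivatives\<close>

lemma prime_dvd_binomial_power_multiple:
  fixes p :: nat
  assumes "prime p" "0 < l" "l < p ^ m"
  shows "p dvd (p ^ m * b choose l)"
proof (rule ccontr)
  assume "\<not> p dvd (p ^ m * b choose l)"
  then have "coprime (p ^ m) (p ^ m * b choose l)"
    using assms prime_imp_coprime by auto
  \<comment> \<open>Absorption: l C(N,l) = N C(N-1,l-1) with N = p^m b.\<close>
  moreover have "p ^ m dvd l * (p ^ m * b choose l)"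
    using assms(2) by (simp add: times_binomial_minus1_eq mult.assoc)
  ultimately have "p ^ m dvd l" by (simp add: coprime_dvd_mult_left_iff)
  with assms show False by (auto dest: dvd_imp_le)
qed

text \<open>Apply Vandermonde to n = q (n div q) + n mod q. Modulo \<open>p\<close> only the summand
  \<open>l = 0\<close> survives, since the others have 0 < l \<le> k < q.\<close>

lemma binomial_mod_power_cong:
  fixes p :: nat
  assumes "prime p" "k < p ^ m"
  shows "(n choose k) mod p = ((n mod p ^ m) choose k) mod p"
proof -
  define q where "q = p ^ m"
  have "n choose k = (\<Sum>l\<le>k. (q * (n div q) choose l) * ((n mod q) choose (k - l)))"
    using vandermonde[of "q * (n div q)" "n mod q" k] by simp
  also have "\<dots> = ((n mod q) choose k) +
      (\<Sum>l\<in>{1..k}. (q * (n div q) choose l) * ((n mod q) choose (k - l)))"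
    by (simp add: atMost_atLeast0 sum.atLeast_Suc_atMost)
  finally have "n choose k = \<dots>" .
  moreover have "p dvd (\<Sum>l\<in>{1..k}. (q * (n div q) choose l) * ((n mod q) choose (k - l)))"
    using assms unfolding q_def
    by (intro dvd_sum dvd_mult2 prime_dvd_binomial_power_multiple) auto
  ultimately show ?thesis
    by (auto simp: q_def elim!: dvdE)
qed

text \<open>The operator x^k \<partial>_k multiplies the coefficient at \<open>n\<close> by C(n,k),
  which modulo \<open>p\<close> depends only on \<open>n mod q\<close>. It thus scales the
  \<open>i\<close>-th component by C(i,k). The factor x^k keeps exponents \<open>i - k\<close> out
  of the formula.\<close>

lemma hasse_deriv_via_sections:
  fixes f :: "'p::prime_card mod_ring fps"
  assumes q: "q = CARD('p) ^ m" and k: "k < q"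
  shows "fls_X ^ k * hasse_deriv k (fps_to_fls f) =
    (\<Sum>i<q. of_nat (i choose k) * (fls_X ^ i * fls_section q i (fps_to_fls f) ^ q))"
proof (rule fls_eqI)
  fix n
  define g where "g = fls_nth (fps_to_fls f)"
  have q0: "q > 0" using k by simp
  have "fls_nth (\<Sum>i<q. of_nat (i choose k) *
          (fls_X ^ i * fls_section q i (fps_to_fls f) ^ q)) n =
      (\<Sum>i<q. if int q dvd n - int i then of_nat (i choose k) * g n else 0)"
    using q0
    by (auto simp: fls_nth_sum fls_nth_X_power_times fls_nth_power_card_power[OF q]
        fls_section.rep_eq g_def intro!: sum.cong)
  also have "\<dots> = of_nat (nat (n mod int q) choose k) * g n"
    by (rule sum_residue_class[OF q0])
  also have "\<dots> = of_int (ibinomial n k) * g n"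
  \<comment> \<open>At negative exponents the power series has coefficient 0, so the congruence is
    applied only to natural upper arguments.\<close>
  proof (cases "n < 0")
    case False
    then obtain n' where n: "n = int n'" by (metis nonneg_int_cases not_less)
    have "(n' choose k) mod CARD('p) = ((n' mod q) choose k) mod CARD('p)"
      unfolding q by (rule binomial_mod_power_cong) (use k q prime_card in auto)
    then have "(of_nat (n' choose k) :: 'p mod_ring) = of_nat ((n' mod q) choose k)"
      by (simp add: of_nat_eq_iff_cong_CHAR cong_def)
    then show ?thesis
      by (simp add: n ibinomial_of_nat zmod_int[symmetric])
  qed (simp add: g_def)
  also have "\<dots> = fls_nth (fls_X ^ k * hasse_deriv k (fps_to_fls f)) n"
    by (simp add: fls_nth_X_power_times hasse_deriv.rep_eq g_def)
  finally show "fls_nth (fls_X ^ k * hasse_deriv k (fps_to_fls f)) n =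
    fls_nth (\<Sum>i<q. of_nat (i choose k) *
      (fls_X ^ i * fls_section q i (fps_to_fls f) ^ q)) n" ..
qed

lemma (in finite_ratfun_extension) hasse_deriv_mem:
  assumes "fps_to_fls f \<in> F"
  shows "hasse_deriv k (fps_to_fls f) \<in> F"
proof -
  \<comment> \<open>The exponent \<open>k\<close> is large enough because k < p^k.\<close>
  define q where "q = CARD('p) ^ k"
  have k: "k < q" unfolding q_def
    using prime_card[where 'a='p] by (intro power_gt_expt) (auto dest: prime_gt_1_nat)
  have "poly_to_fls [:0, 1:] \<in> F" by (rule poly_mem)
  then have X: "fls_X ^ i \<in> F" for i
    by (intro power_mem) (simp add: fps_of_poly_pCons)
  have nat: "of_nat i \<in> F" for i
    by (induction i) (auto intro: add_mem one_mem ratfun.subspace_0[OF subspace])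
  have "fls_X ^ k * hasse_deriv k (fps_to_fls f) \<in> F"
    unfolding hasse_deriv_via_sections[OF q_def k]
    by (intro sum_mem times_mem nat X power_mem section_mem[OF q_def] assms) simp
  then have "fls_X ^ k * hasse_deriv k (fps_to_fls f) / fls_X ^ k \<in> F"
    by (intro divide_mem X) auto
  then show ?thesis by (simp only: nonzero_mult_div_cancel_left[OF power_not_zero[OF fls_X_nonzero]])
qed

section \<open>The finite extension generated by an algebraic series\<close>

lemma algebraic_finite_ratfun_extension:
  fixes P :: "'p::prime_card mod_ring poly poly" and f :: "'p mod_ring fps"
  assumes "P \<noteq> 0" "poly (map_poly fps_of_poly P) f = 0"
  shows "\<exists>F B. finite_ratfun_extension F B \<and> fps_to_fls f \<in> F"
proof -
  define g where "g = fps_to_fls f"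
  define n where "n = degree P"
  \<comment> \<open>\<open>P\<close> may be reducible, so these powers of \<open>g\<close> may be
    dependent; the locale asks only that they span \<open>F\<close>.\<close>
  define B where "B = (\<lambda>i. g ^ i) ` {..<n}"
  define F where "F = ratfun.span B"
  define c where "c i = poly_to_fls (poly.coeff P i)" for i
  have sub: "ratfun.subspace F" by (simp add: F_def)
  have scale: "ratfun_to_fls r * u \<in> F" if "u \<in> F" for r u
    using ratfun.subspace_scale[OF sub that, of r] by (simp add: ratfun_scale_def)
  have low: "g ^ i \<in> F" if "i < n" for i
    using that by (auto simp: F_def B_def intro: ratfun.span_base)
  have "poly (map_poly fps_of_poly P) f = (\<Sum>i\<le>n. fps_of_poly (poly.coeff P i) * f ^ i)"
    unfolding n_def by (subst poly_altdef) (auto simp: coeff_map_poly degree_map_poly)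
  then have "(\<Sum>i\<le>n. fps_of_poly (poly.coeff P i) * f ^ i) = 0" using assms by simp
  then have "fps_to_fls (\<Sum>i\<le>n. fps_of_poly (poly.coeff P i) * f ^ i) = 0" by simp
  moreover have "fps_to_fls (sum h A) = (\<Sum>i\<in>A. fps_to_fls (h i))"
    for h :: "nat \<Rightarrow> 'p mod_ring fps" and A
    by (induction A rule: infinite_finite_induct) simp_all
  ultimately have "(\<Sum>i\<le>n. c i * g ^ i) = 0"
    by (simp add: fls_times_fps_to_fls fps_to_fls_power c_def g_def)
  then have rel: "c n * g ^ n = (\<Sum>i<n. (- c i) * g ^ i)"
    by (simp add: lessThan_Suc_atMost[symmetric] sum_negf add_eq_0_iff2)
  have cn: "c n \<noteq> 0" using assms by (simp add: c_def n_def)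
  \<comment> \<open>Dividing by the leading coefficient expresses g^n by lower powers.\<close>
  have "g ^ n = (\<Sum>i<n. ratfun_to_fls (Fract (- poly.coeff P i) (poly.coeff P n)) * g ^ i)"
  proof -
    have "g ^ n = (\<Sum>i<n. (- c i) * g ^ i) / c n"
      using rel cn by (simp add: field_simps)
    also have "\<dots> = (\<Sum>i<n. (- c i) / c n * g ^ i)"
      by (simp add: sum_divide_distrib)
    finally show ?thesis
      using assms by (simp add: ratfun_to_fls_Fract c_def n_def fps_of_poly_uminus)
  qed
  also have "\<dots> \<in> F"
    by (intro ratfun.subspace_sum[OF sub] scale low) simp
  finally have gn: "g ^ n \<in> F" .
  have gmult: "g * u \<in> F" if "u \<in> F" for u
    using that unfolding F_def
  proof (induction rule: ratfun.span_induct_alt)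
    case base
    show ?case by (simp add: ratfun.span_zero)
  next
    case (step r x y)
    then obtain i where i: "i < n" "x = g ^ i" by (auto simp: B_def)
    \<comment> \<open>Only the top power leaves the generating set, and then \<open>gn\<close>
      applies.\<close>
    have "g * x \<in> F"
      using low[of "Suc i"] gn i by (cases "Suc i = n") auto
    then have "ratfun_to_fls r * (g * x) \<in> F" by (rule scale)
    with step have "ratfun_to_fls r * (g * x) + g * y \<in> F"
      unfolding F_def by (intro ratfun.span_add)
    moreover have "ratfun_to_fls r * (g * x) + g * y = g * (ratfun_scale r x + y)"
      by (simp add: ratfun_scale_def algebra_simps)
    ultimately show ?case by (simp add: F_def)
  qed
  have one: "1 \<in> F"
    \<comment> \<open>For \<open>n = 0\<close>, \<open>gn\<close> itself says that g^0 = 1 lies in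
      \<open>F\<close>; constant \<open>P\<close>, which cannot vanish at \<open>f\<close>, is
      covered in this way.\<close>
    using low[of 0] gn by (cases "n = 0") auto
  have power: "g ^ i * u \<in> F" if "u \<in> F" for i u
    using that by (induction i) (auto simp: mult.assoc intro: gmult)
  have "u * v \<in> F" if "u \<in> F" "v \<in> F" for u v
    using that(1) unfolding F_def
  proof (induction rule: ratfun.span_induct_alt)
    case base
    show ?case by (simp add: ratfun.span_zero)
  next
    case (step r x y)
    then obtain i where "x = g ^ i" by (auto simp: B_def)
    then have "ratfun_to_fls r * (x * v) \<in> F"
      using that by (auto intro: scale power)
    with step have "ratfun_to_fls r * (x * v) + y * v \<in> F"
      unfolding F_def by (intro ratfun.span_add)
    moreover have "ratfun_to_fls r * (x * v) + y * v = (ratfun_scale r x + y) * v"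
      by (simp add: ratfun_scale_def algebra_simps)
    ultimately show ?case by (simp add: F_def)
  qed
  then have "finite_ratfun_extension F B"
    using one by unfold_locales (auto simp: B_def F_def)
  moreover have "g \<in> F" using gmult[OF one] by simp
  ultimately show ?thesis unfolding g_def by blast
qed

section \<open>Finiteness of the extension generated by the logarithmic derivatives\<close>

lemma subspace_ratfun_adjoin: "ratfun.subspace (ratfun_adjoin S)"
proof (rule ratfun.subspaceI)
  show "0 \<in> ratfun_adjoin S" using ratfun_adjoin.scalar[of 0 S] by simp
qed (auto simp: ratfun_scale_def intro: ratfun_adjoin.intros)

theorem theorem4p1:
  fixes \<alpha> :: "nat \<Rightarrow> 'p::prime_card mod_ring fps"
    and f :: "'p mod_ring fps"
  assumes "f \<noteq> 0"
    and "\<forall>k\<ge>1. higher_dlog k (fps_to_fls f) = fps_to_fls (\<alpha> k)"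
    and "infinite_extension (ratfun_adjoin {fps_to_fls (\<alpha> i) | i. i \<ge> 1})"
  shows "transcendental_over_polys f"
  unfolding transcendental_over_polys_def
proof (intro allI impI notI)
  fix P :: "'p mod_ring poly poly"
  assume "P \<noteq> 0" "poly (map_poly fps_of_poly P) f = 0"
  then obtain F B where "finite_ratfun_extension F B" and f: "fps_to_fls f \<in> F"
    using algebraic_finite_ratfun_extension by blast
  then interpret finite_ratfun_extension F B by simp
  let ?R = "ratfun_adjoin {fps_to_fls (\<alpha> i) | i. i \<ge> 1}"
  have alpha: "fps_to_fls (\<alpha> i) \<in> F" if "i \<ge> 1" for i
  proof -
    have "hasse_deriv i (fps_to_fls f) / fps_to_fls f \<in> F"
      using assms(1) f by (intro divide_mem hasse_deriv_mem) auto
    with assms(2) that show ?thesis by (simp add: higher_dlog_def)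
  qed
  have "u \<in> F" if "u \<in> ?R" for u
    using that by induction (auto intro: alpha scalar_mem add_mem times_mem)
  then have "?R \<subseteq> F" by blast
  \<comment> \<open>As a subspace of the finite-dimensional \<open>F\<close>, the adjoined ring has
    a finite spanning set within itself, which \<open>infinite_extension\<close> denies.\<close>
  then obtain C where "C \<subseteq> ?R" "finite C" "ratfun.span C = ?R"
    by (rule obtain_basis[OF _ subspace_ratfun_adjoin])
  with assms(3) show False by (auto simp: infinite_extension_def)
qed

end
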